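(* Let $n\ge1$, $\lambda=(n,n)$, and let $\psi:W^\lambda\to S^\lambda$ be the $S_{2n}$-module isomorphism inverse to $\rho$. Let $w$ be a cup diagram on $2n$ dots. Then $\psi(w)=v_T$, where $T$ is a tableau of shape $(n,n)$ (not necessarily standard) such that the two entries in each column of $T$ are connected by an arc in $w$, with the smaller entry on top. Moreover, $v_T$ is well-defined by this condition (i.e. any two tableaux $T$ satisfying this condition have the same polytabloid $v_T$).
   Context: All vector spaces are over $\mathbb{C}$; $s_i=(i\ \ i+1)$, $1\le i\le 2n-1$, are the simple transpositions of $S_{2n}$. A tableau of shape $(n,n)$ is a bijective filling of two rows of length $n$ with $1,\dots,2n$; $S_{2n}$ acts on tableaux by acting on entries. $T_0$ is the tableau with $1,2,\dots,2n$ placed down successive columns (columns $(1,2),(3,4),\dots,(2n-1,2n)$). Specht module. $S^\lambda$ is the Specht module with its polytabloids $v_T$ ($T$ any tableau of shape $\lambda$), $v_T=\sum_{\sigma}\operatorname{sgn}(\sigma)\{\sigma T\}$, where $\sigma$ runs over the column stabilizer of $T$ and $\{\cdot\}$ denotes the tabloid (row-equivalence class); thus $\sigma.v_T=v_{\sigma.T}$ for $\sigma\in S_{2n}$, and $s_i.v_T=-v_T$ if $i,i+1$ are in the same column of $T$. The $v_T$ with $T$ standard form a basis of $S^\lambda$. Webs. A cup diagram (web) on $2n$ dots labeled $1,\dots,2n$ from left to right on a horizontal axis is a noncrossing perfect matching of the dots, with arcs drawn below the axis. $W^\lambda$ is the $\mathbb{C}$-vector space with basis the set of cup diagrams. $S_{2n}$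 acts on it by: $s_i.w=-w$ if $i$ and $i+1$ are joined by an arc of $w$; otherwise $s_i.w=w+w'$, where $w'$ is the cup diagram obtained from $w$ by replacing the two arcs incident to $i$ and to $i+1$ by the arc joining $i$ and $i+1$ and the arc joining the former partners of $i$ and $i+1$. Isomorphism. $S^\lambda$ and $W^\lambda$ are isomorphic irreducible $S_{2n}$-modules; $\rho:S^\lambda\to W^\lambda$ is the unique $S_{2n}$-isomorphism with $\rho(v_{T_0})=w_0$, where $w_0$ is the cup diagram with arcs $(1,2),(3,4),\dots,(2n-1,2n)$, and $\psi=\rho^{-1}$. *)

theory Defs
  imports
    Complex_Main
    "HOL-Combinatorics.Permutations"
    "HOL-Library.Disjoint_Sets"
    "HOL-Library.Poly_Mapping"
    "HOL-Algebra.Sym_Groups"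
    "HOL-Algebra.Group_Action"
begin

section \<open>Free complex vector spaces\<close>

text \<open>
  The finitely supported functions \<open>'a \<Rightarrow>\<^sub>0 complex\<close> form the complex vector space with basis
  \<open>'a\<close>; the basis vector attached to \<open>a\<close> is \<open>Poly_Mapping.single a 1\<close>.
\<close>

definition cscale :: "complex \<Rightarrow> ('a \<Rightarrow>\<^sub>0 complex) \<Rightarrow> ('a \<Rightarrow>\<^sub>0 complex)"
  where "cscale c x = Poly_Mapping.map (\<lambda>a. c * a) x"

lemma lookup_cscale: "Poly_Mapping.lookup (cscale c x) a = c * Poly_Mapping.lookup x a"
  by (simp add: cscale_def Poly_Mapping.map.rep_eq when_def)

interpretation free_vs: vector_space cscale
  by unfold_locales
    (auto intro!: poly_mapping_eqI simp: lookup_cscale lookup_add algebra_simps)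

definition basis_vec :: "'a \<Rightarrow> ('a \<Rightarrow>\<^sub>0 complex)"
  where "basis_vec a = Poly_Mapping.single a 1"

definition linear_on ::
    "('a \<Rightarrow>\<^sub>0 complex) set \<Rightarrow> (('a \<Rightarrow>\<^sub>0 complex) \<Rightarrow> ('b \<Rightarrow>\<^sub>0 complex)) \<Rightarrow> bool"
  where "linear_on V f \<longleftrightarrow>
    (\<forall>x\<in>V. \<forall>y\<in>V. f (x + y) = f x + f y) \<and> (\<forall>c. \<forall>x\<in>V. f (cscale c x) = cscale c (f x))"

definition push_forward :: "('a \<Rightarrow> 'b) \<Rightarrow> ('a \<Rightarrow>\<^sub>0 complex) \<Rightarrow> ('b \<Rightarrow>\<^sub>0 complex)"
  where "push_forward f x =
    (\<Sum>a\<in>Poly_Mapping.keys x. cscale (Poly_Mapping.lookup x a) (basis_vec (f a)))"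


section \<open>Tableaux, tabloids and the Specht module of shape \<open>(n, n)\<close>\<close>

text \<open>
  A filling is given by its top and bottom row; column \<open>j < n\<close> consists of the \<open>j\<close>-th entries
  of the two rows, counted from zero.
\<close>

type_synonym tableau = "nat list \<times> nat list"

definition tableaux :: "nat \<Rightarrow> tableau set"
  where "tableaux n = {(a, b). length a = n \<and> length b = n \<and>
    distinct (a @ b) \<and> set (a @ b) = {1..2 * n}}"

definition tableau_act :: "(nat \<Rightarrow> nat) \<Rightarrow> tableau \<Rightarrow> tableau"
  where "tableau_act \<sigma> = map_prod (map \<sigma>) (map \<sigma>)"

definition row_equiv :: "nat \<Rightarrow> (tableau \<times> tableau) set"
  where "row_equiv n = {(T, T'). T \<in> tableaux n \<and> T' \<in> tableaux n \<and>
    set (fst T) = set (fst T') \<and> set (snd T) = set (snd T')}"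

type_synonym tabloid = "tableau set"

definition tabloid_of :: "nat \<Rightarrow> tableau \<Rightarrow> tabloid"
  where "tabloid_of n T = row_equiv n `` {T}"

definition column_stabilizer :: "nat \<Rightarrow> tableau \<Rightarrow> (nat \<Rightarrow> nat) set"
  where "column_stabilizer n T = {\<sigma>. \<sigma> permutes {1..2 * n} \<and>
    (\<forall>j<n. \<sigma> ` {fst T ! j, snd T ! j} = {fst T ! j, snd T ! j})}"

definition polytabloid :: "nat \<Rightarrow> tableau \<Rightarrow> (tabloid \<Rightarrow>\<^sub>0 complex)"
  where "polytabloid n T = (\<Sum>\<sigma>\<in>column_stabilizer n T.
    cscale (of_int (sign \<sigma>)) (basis_vec (tabloid_of n (tableau_act \<sigma> T))))"

definition specht :: "nat \<Rightarrow> (tabloid \<Rightarrow>\<^sub>0 complex) set"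
  where "specht n = free_vs.span (polytabloid n ` tableaux n)"

text \<open>For a permutation \<open>\<sigma>\<close> of the entries, the image of the tabloid of \<open>T\<close> under
  \<open>tableau_act \<sigma>\<close> is the tabloid of \<open>tableau_act \<sigma> T\<close>.\<close>

definition specht_act :: "(nat \<Rightarrow> nat) \<Rightarrow> (tabloid \<Rightarrow>\<^sub>0 complex) \<Rightarrow> (tabloid \<Rightarrow>\<^sub>0 complex)"
  where "specht_act \<sigma> = push_forward (\<lambda>X. tableau_act \<sigma> ` X)"

definition T\<^sub>0 :: "nat \<Rightarrow> tableau"
  where "T\<^sub>0 n = (map (\<lambda>j. 2 * j + 1) [0..<n], map (\<lambda>j. 2 * j + 2) [0..<n])"


section \<open>Cup diagrams and the web module\<close>

text \<open>A cup diagram is the set of its arcs, each arc being the set of its two endpoints.\<close>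

type_synonym web = "nat set set"

definition cup_diagrams :: "nat \<Rightarrow> web set"
  where "cup_diagrams n = {w. partition_on {1..2 * n} w \<and> (\<forall>e\<in>w. card e = 2) \<and>
    (\<nexists>i j k l. i < j \<and> j < k \<and> k < l \<and> {i, k} \<in> w \<and> {j, l} \<in> w)}"

definition web_space :: "nat \<Rightarrow> (web \<Rightarrow>\<^sub>0 complex) set"
  where "web_space n = free_vs.span (basis_vec ` cup_diagrams n)"

definition partner :: "web \<Rightarrow> nat \<Rightarrow> nat"
  where "partner w i = (THE j. {i, j} \<in> w)"

definition reconnect :: "nat \<Rightarrow> web \<Rightarrow> web"
  where "reconnect i w =
    (w - {{i, partner w i}, {i + 1, partner w (i + 1)}}) \<union>
    {{i, i + 1}, {partner w i, partner w (i + 1)}}"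

text \<open>
  The linear actions of the symmetric group on the web space for which the simple transpositions
  act by the skein rule. As these generate the group, this determines \<open>act \<sigma>\<close> on the web space
  for every permutation \<open>\<sigma>\<close>.
\<close>

definition web_action :: "nat \<Rightarrow> ((nat \<Rightarrow> nat) \<Rightarrow> (web \<Rightarrow>\<^sub>0 complex) \<Rightarrow> (web \<Rightarrow>\<^sub>0 complex)) \<Rightarrow> bool"
  where "web_action n act \<longleftrightarrow>
    group_action (sym_group (2 * n)) (web_space n) act \<and>
    (\<forall>\<sigma>\<in>carrier (sym_group (2 * n)). linear_on (web_space n) (act \<sigma>)) \<and>
    (\<forall>w\<in>cup_diagrams n. \<forall>i\<in>{1..2 * n - 1}. act (transpose i (i + 1)) (basis_vec w) =
      (if {i, i + 1} \<in> w then - basis_vec w else basis_vec w + basis_vec (reconnect i w)))"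

definition w\<^sub>0 :: "nat \<Rightarrow> web"
  where "w\<^sub>0 n = (\<lambda>j. {2 * j + 1, 2 * j + 2}) ` {..<n}"

definition specht_web_iso ::
    "nat \<Rightarrow> ((nat \<Rightarrow> nat) \<Rightarrow> (web \<Rightarrow>\<^sub>0 complex) \<Rightarrow> (web \<Rightarrow>\<^sub>0 complex)) \<Rightarrow>
      ((tabloid \<Rightarrow>\<^sub>0 complex) \<Rightarrow> (web \<Rightarrow>\<^sub>0 complex)) \<Rightarrow> bool"
  where "specht_web_iso n act \<rho> \<longleftrightarrow>
    bij_betw \<rho> (specht n) (web_space n) \<and> linear_on (specht n) \<rho> \<and>
    (\<forall>\<sigma>\<in>carrier (sym_group (2 * n)). \<forall>x\<in>specht n. \<rho> (specht_act \<sigma> x) = act \<sigma> (\<rho> x))"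

definition columns_are_arcs :: "nat \<Rightarrow> web \<Rightarrow> tableau \<Rightarrow> bool"
  where "columns_are_arcs n w T \<longleftrightarrow>
    (\<forall>j<n. {fst T ! j, snd T ! j} \<in> w \<and> fst T ! j < snd T ! j)"

end

theory Submission
  imports Defs
begin

text \<open>
  The coefficient of \<open>v\<^sub>T\<close> at the tabloid with top row \<open>A\<close> is the product of
  \<open>\<chi>\<^sub>A(a) - \<chi>\<^sub>A(b)\<close> over the columns \<open>(a, b)\<close> of \<open>T\<close>. Hence \<open>v\<^sub>T\<close> depends only on the set of
  columns, and the identity \<open>(a - c)(b - d) = (a - b)(c - d) + (a - d)(b - c)\<close> is a three-term
  relation between polytabloids. A cup diagram \<open>w \<noteq> w\<^sub>0\<close> contains arcs \<open>{p, q}\<close> and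
  \<open>{p + 1, p + 2}\<close> with \<open>p + 2 < q\<close>. Replacing them by \<open>{p, p + 1}\<close> and \<open>{p + 2, q}\<close> gives a cup
  diagram of smaller total arc length, and the skein rule for \<open>s\<^bsub>p+1\<^esub>\<close> on it is this
  three-term relation, so \<open>\<rho>\<close> maps \<open>v\<^sub>T\<close> to \<open>w\<close> by induction on the total arc length.
\<close>

section \<open>Alternating sums over column stabilizers\<close>

text \<open>This is the column stabilizer for two arbitrary lists instead of a tableau with entries
  \<open>{1..2 * n}\<close>. Removing the first column stays within this setting, which makes
  induction on the columns possible.\<close>

definition pair_stabilizer :: "'a list \<Rightarrow> 'a list \<Rightarrow> ('a \<Rightarrow> 'a) set"
  where "pair_stabilizer xs ys = {\<sigma>. \<sigma> permutes (set xs \<union> set ys) \<and>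
    (\<forall>(x, y)\<in>set (zip xs ys). \<sigma> ` {x, y} = {x, y})}"

lemma pair_stabilizer_Nil: "pair_stabilizer [] [] = {id}"
  by (auto simp: pair_stabilizer_def permutes_empty)

lemma finite_pair_stabilizer: "finite (pair_stabilizer xs ys)"
  by (rule finite_subset[OF _ finite_permutations[of "set xs \<union> set ys"]])
    (auto simp: pair_stabilizer_def)

text \<open>The first column is disjoint from the others, so the stabilizer is the product of the
  smaller stabilizer with the group of order two generated by \<open>transpose x y\<close>. The two
  sets on the right are the cosets of the smaller stabilizer.\<close>

lemma pair_stabilizer_Cons:
  assumes "length xs = length ys" and dist: "distinct ((x # xs) @ (y # ys))"
  shows "pair_stabilizer (x # xs) (y # ys) =
    pair_stabilizer xs ys \<union> (\<lambda>\<sigma>. \<sigma> \<circ> transpose x y) ` pair_stabilizer xs ys"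
proof (intro equalityI subsetI)
  have ne: "a \<noteq> x" "a \<noteq> y" "b \<noteq> x" "b \<noteq> y" if "(a, b) \<in> set (zip xs ys)" for a b
    using dist set_zip_leftD[OF that] set_zip_rightD[OF that] by auto
  have xy: "x \<noteq> y" using dist by auto
  fix \<sigma>
  {
    assume "\<sigma> \<in> pair_stabilizer (x # xs) (y # ys)"
    then have perm: "\<sigma> permutes (insert x (insert y (set xs \<union> set ys)))"
      and im: "\<sigma> ` {x, y} = {x, y}"
      and cols: "\<forall>(x, y)\<in>set (zip xs ys). \<sigma> ` {x, y} = {x, y}"
      by (auto simp: pair_stabilizer_def insert_commute)
    have fixing: "\<pi> permutes (set xs \<union> set ys)"
      if "\<pi> permutes (insert x (insert y (set xs \<union> set ys)))" "\<pi> x = x" "\<pi> y = y" for \<pi>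
      by (rule permutes_superset[OF that(1)]) (use that in auto)
    consider "\<sigma> x = x" "\<sigma> y = y" | "\<sigma> x = y" "\<sigma> y = x"
      using im xy by (auto simp: doubleton_eq_iff)
    then show "\<sigma> \<in> pair_stabilizer xs ys \<union> (\<lambda>\<sigma>. \<sigma> \<circ> transpose x y) ` pair_stabilizer xs ys"
    proof cases
      case 1
      then show ?thesis using fixing[OF perm] cols by (auto simp: pair_stabilizer_def)
    next
      case 2
      \<comment> \<open>Here \<sigma> exchanges \<open>x\<close> and \<open>y\<close>; precomposing
        with the transposition gives a permutation that fixes both.\<close>
      let ?\<pi> = "\<sigma> \<circ> transpose x y"
      have "?\<pi> permutes (insert x (insert y (set xs \<union> set ys)))"
        by (rule permutes_compose[OF _ perm]) (simp add: permutes_swap_id)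
      then have "?\<pi> permutes (set xs \<union> set ys)" by (rule fixing) (use 2 in auto)
      moreover have "\<forall>(a, b)\<in>set (zip xs ys). ?\<pi> ` {a, b} = {a, b}"
        using cols ne by (fastforce simp: transpose_def)
      ultimately have "?\<pi> \<in> pair_stabilizer xs ys" by (simp add: pair_stabilizer_def)
      moreover have "\<sigma> = ?\<pi> \<circ> transpose x y" by (simp add: comp_assoc)
      ultimately show ?thesis by blast
    qed
  }
  assume "\<sigma> \<in> pair_stabilizer xs ys \<union> (\<lambda>\<sigma>. \<sigma> \<circ> transpose x y) ` pair_stabilizer xs ys"
  then obtain \<pi> where \<pi>: "\<pi> \<in> pair_stabilizer xs ys" and \<sigma>: "\<sigma> = \<pi> \<or> \<sigma> = \<pi> \<circ> transpose x y"
    by auto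
  have perm: "\<pi> permutes (set xs \<union> set ys)" and cols: "\<forall>(a, b)\<in>set (zip xs ys). \<pi> ` {a, b} = {a, b}"
    using \<pi> by (auto simp: pair_stabilizer_def)
  have "\<pi> x = x" "\<pi> y = y" using permutes_not_in[OF perm] dist by auto
  moreover have "\<pi> permutes (insert x (insert y (set xs \<union> set ys)))"
    by (rule permutes_subset[OF perm]) auto
  moreover have "\<pi> \<circ> transpose x y permutes (insert x (insert y (set xs \<union> set ys)))"
    by (rule permutes_compose[OF _ calculation(3)]) (simp add: permutes_swap_id)
  moreover have "\<forall>(a, b)\<in>set (zip xs ys). (\<pi> \<circ> transpose x y) ` {a, b} = {a, b}"
    using cols ne by (fastforce simp: transpose_def)
  ultimately have "\<pi> \<in> pair_stabilizer (x # xs) (y # ys)"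
    and "\<pi> \<circ> transpose x y \<in> pair_stabilizer (x # xs) (y # ys)"
    using cols by (simp_all add: pair_stabilizer_def insert_commute)
  then show "\<sigma> \<in> pair_stabilizer (x # xs) (y # ys)" using \<sigma> by blast
qed

text \<open>An element of the stabilizer decides independently for each column whether to swap it,
  and each swap costs a sign and replaces \<open>f x\<close> by \<open>- f y\<close>. Summing over
  all choices gives the expanded product of the differences.\<close>

lemma sum_sign_pair_stabilizer:
  fixes f :: "'a \<Rightarrow> 'b :: comm_ring_1"
  assumes "length xs = length ys" "distinct (xs @ ys)"
  shows "(\<Sum>\<sigma>\<in>pair_stabilizer xs ys. of_int (sign \<sigma>) * (\<Prod>x\<in>set xs. f (\<sigma> x))) =
    (\<Prod>(x, y)\<in>set (zip xs ys). f x - f y)"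
  using assms
proof (induction xs ys rule: list_induct2)
  case Nil
  then show ?case by (simp add: pair_stabilizer_Nil)
next
  case (Cons x xs y ys)
  let ?S = "pair_stabilizer xs ys"
  let ?g = "\<lambda>\<sigma>. of_int (sign \<sigma>) * (\<Prod>z\<in>set xs. f (\<sigma> z))"
  have xy: "x \<noteq> y" and nin: "x \<notin> set xs" "y \<notin> set xs" "x \<notin> set ys" "y \<notin> set ys"
    using Cons.prems by auto
  have fixes_xy: "\<sigma> x = x" "\<sigma> y = y" and perm: "permutation \<sigma>" if "\<sigma> \<in> ?S" for \<sigma>
    using that nin permutes_not_in[of \<sigma> "set xs \<union> set ys"]
      permutes_imp_permutation[of "set xs \<union> set ys" \<sigma>]
    by (auto simp: pair_stabilizer_def)
  have inj: "inj_on (\<lambda>\<sigma>. \<sigma> \<circ> transpose x y) ?S"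
  proof (rule inj_onI)
    fix \<sigma> \<tau> assume "\<sigma> \<circ> transpose x y = \<tau> \<circ> transpose x y"
    then have "\<sigma> \<circ> transpose x y \<circ> transpose x y = \<tau> \<circ> transpose x y \<circ> transpose x y" by simp
    then show "\<sigma> = \<tau>" by (simp add: comp_assoc)
  qed
  have disj: "?S \<inter> (\<lambda>\<sigma>. \<sigma> \<circ> transpose x y) ` ?S = {}"
    using fixes_xy xy by fastforce
  \<comment> \<open>The transposition moves only \<open>x\<close> and \<open>y\<close>, neither of
    which occurs in \<open>xs\<close>.\<close>
  have prod_swap: "(\<Prod>z\<in>set xs. f ((\<sigma> \<circ> transpose x y) z)) = (\<Prod>z\<in>set xs. f (\<sigma> z))" for \<sigma>
    by (rule prod.cong) (use nin in \<open>auto simp: transpose_def\<close>)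
  have "(\<Sum>\<sigma>\<in>pair_stabilizer (x # xs) (y # ys).
      of_int (sign \<sigma>) * (\<Prod>z\<in>set (x # xs). f (\<sigma> z))) =
    (\<Sum>\<sigma>\<in>?S. of_int (sign \<sigma>) * (\<Prod>z\<in>set (x # xs). f (\<sigma> z))) +
    (\<Sum>\<sigma>\<in>?S. of_int (sign (\<sigma> \<circ> transpose x y)) *
      (\<Prod>z\<in>set (x # xs). f ((\<sigma> \<circ> transpose x y) z)))"
    unfolding pair_stabilizer_Cons[OF Cons.hyps Cons.prems]
    by (subst sum.union_disjoint)
      (use finite_pair_stabilizer disj in \<open>auto simp: sum.reindex[OF inj]\<close>)
  also have "\<dots> = (\<Sum>\<sigma>\<in>?S. ?g \<sigma> * f x) + (\<Sum>\<sigma>\<in>?S. - (?g \<sigma> * f y))"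
  proof (intro arg_cong2[where f = "(+)"] sum.cong refl)
    fix \<sigma> assume \<sigma>: "\<sigma> \<in> ?S"
    show "of_int (sign \<sigma>) * (\<Prod>z\<in>set (x # xs). f (\<sigma> z)) = ?g \<sigma> * f x"
      using nin fixes_xy[OF \<sigma>] by (simp add: mult_ac)
    have "sign (\<sigma> \<circ> transpose x y) = - sign \<sigma>"
      using xy perm[OF \<sigma>] by (simp add: sign_compose permutation_swap_id sign_swap_id)
    then show "of_int (sign (\<sigma> \<circ> transpose x y)) *
        (\<Prod>z\<in>set (x # xs). f ((\<sigma> \<circ> transpose x y) z)) = - (?g \<sigma> * f y)"
      using nin fixes_xy[OF \<sigma>] prod_swap[of \<sigma>] by (simp add: mult_ac)
  qed
  also have "\<dots> = (f x - f y) * (\<Sum>\<sigma>\<in>?S. ?g \<sigma>)"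
    by (simp only: sum_negf sum_distrib_right[symmetric]) (simp add: algebra_simps)
  also have "\<dots> = (\<Prod>(x, y)\<in>set (zip (x # xs) (y # ys)). f x - f y)"
  proof -
    \<comment> \<open>The product ranges over a set of columns, so the factor of the new column
      splits off only if that column does not occur among the others.\<close>
    have "(x, y) \<notin> set (zip xs ys)" using nin by (auto dest: set_zip_leftD)
    then show ?thesis using Cons.IH Cons.prems by simp
  qed
  finally show ?case .
qed

section \<open>Coefficients of polytabloids\<close>

text \<open>This forgets the order of the columns but keeps top and bottom apart, since exchanging
  them changes the sign of the polytabloid.\<close>

definition columns :: "tableau \<Rightarrow> (nat \<times> nat) set"
  where "columns T = set (zip (fst T) (snd T))"

lemma columns_conv_nth:
  assumes "T \<in> tableaux n"
  shows "columns T = {(fst T ! j, snd T ! j) |j. j < n}"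
  using assms by (auto simp: columns_def set_zip tableaux_def)

lemma column_stabilizer_eq:
  assumes "T \<in> tableaux n"
  shows "column_stabilizer n T = pair_stabilizer (fst T) (snd T)"
proof -
  have "{1..2 * n} = set (fst T) \<union> set (snd T)"
    using assms by (auto simp: tableaux_def)
  moreover have "(\<forall>j<n. \<sigma> ` {fst T ! j, snd T ! j} = {fst T ! j, snd T ! j}) \<longleftrightarrow>
    (\<forall>(x, y)\<in>set (zip (fst T) (snd T)). \<sigma> ` {x, y} = {x, y})" for \<sigma>
    using columns_conv_nth[OF assms] by (auto simp: columns_def)
  ultimately show ?thesis
    unfolding column_stabilizer_def pair_stabilizer_def by (simp only:)
qed

lemma tableau_act_tableaux:
  assumes "T \<in> tableaux n" "\<sigma> permutes {1..2 * n}"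
  shows "tableau_act \<sigma> T \<in> tableaux n"
proof -
  have inj: "inj \<sigma>" and im: "\<sigma> ` {1..2 * n} = {1..2 * n}"
    using assms(2) by (auto simp: permutes_inj permutes_image)
  obtain a b where T: "T = (a, b)" by force
  have ab: "distinct (a @ b)" "set (a @ b) = {1..2 * n}" "length a = n" "length b = n"
    using assms(1) by (auto simp: T tableaux_def)
  have "distinct (map \<sigma> (a @ b))"
    using ab(1) inj_on_subset[OF inj subset_UNIV] by (subst distinct_map) blast
  moreover have "set (map \<sigma> (a @ b)) = {1..2 * n}"
    using ab(2) im by (simp only: set_map)
  ultimately show ?thesis
    using ab(3,4) unfolding T tableaux_def tableau_act_def by simp
qed

lemma columns_tableau_act: "columns (tableau_act \<sigma> T) = map_prod \<sigma> \<sigma> ` columns T"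
  by (simp add: columns_def tableau_act_def zip_map_map map_prod_def split_beta)

text \<open>The bottom row is the complement of the top row in \<open>{1..2 * n}\<close>.\<close>

lemma tabloid_of_eq_iff:
  assumes "T \<in> tableaux n" "T' \<in> tableaux n"
  shows "tabloid_of n T = tabloid_of n T' \<longleftrightarrow> set (fst T) = set (fst T')"
proof -
  have snd_eq: "set (snd U) = {1..2 * n} - set (fst U)" if "U \<in> tableaux n" for U
    using that by (auto simp: tableaux_def)
  have mem: "U \<in> tabloid_of n U" if "U \<in> tableaux n" for U
    using that by (auto simp: tabloid_of_def row_equiv_def)
  show ?thesis
  proof
    assume "tabloid_of n T = tabloid_of n T'"
    with mem[OF assms(1)] show "set (fst T) = set (fst T')"
      by (auto simp: tabloid_of_def row_equiv_def)
  next
    assume "set (fst T) = set (fst T')"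
    with assms snd_eq show "tabloid_of n T = tabloid_of n T'"
      by (auto simp: tabloid_of_def row_equiv_def)
  qed
qed

lemma lookup_basis_vec: "Poly_Mapping.lookup (basis_vec a) b = (if a = b then 1 else 0)"
  by (simp add: basis_vec_def lookup_single when_def)

text \<open>Only those \<sigma> contribute that carry the top row of \<open>T\<close> onto the top
  row of \<open>U\<close>. That condition is a product of indicator values over the top row of
  \<open>T\<close>, so the alternating sum formula applies with \<open>f\<close> the characteristic
  function of the top row of \<open>U\<close>.\<close>

lemma lookup_polytabloid:
  assumes "T \<in> tableaux n" "U \<in> tableaux n"
  shows "Poly_Mapping.lookup (polytabloid n T) (tabloid_of n U) =
    (\<Prod>(a, b)\<in>columns T. of_bool (a \<in> set (fst U)) - of_bool (b \<in> set (fst U)))"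
proof -
  let ?A = "set (fst U)"
  have "(if tabloid_of n (tableau_act \<sigma> T) = tabloid_of n U then 1 else 0 :: complex) =
      (\<Prod>x\<in>set (fst T). of_bool (\<sigma> x \<in> ?A))" if "\<sigma> \<in> column_stabilizer n T" for \<sigma>
  proof -
    have perm: "\<sigma> permutes {1..2 * n}" using that by (simp add: column_stabilizer_def)
    \<comment> \<open>Both sets have \<open>n\<close> elements, so equality reduces to inclusion,
      which can be tested entry by entry.\<close>
    have "card (\<sigma> ` set (fst T)) = n" "card ?A = n"
      using assms card_image[OF inj_on_subset[OF permutes_inj[OF perm]], of "set (fst T)"]
      by (auto simp: tableaux_def distinct_card)
    then have "\<sigma> ` set (fst T) = ?A \<longleftrightarrow> \<sigma> ` set (fst T) \<subseteq> ?A"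
      using card_subset_eq[of ?A "\<sigma> ` set (fst T)"] by auto
    then have "tabloid_of n (tableau_act \<sigma> T) = tabloid_of n U \<longleftrightarrow> (\<forall>x\<in>set (fst T). \<sigma> x \<in> ?A)"
      using tabloid_of_eq_iff[OF tableau_act_tableaux[OF assms(1) perm] assms(2)]
      by (auto simp: tableau_act_def)
    then show ?thesis by (auto simp: prod_zero_iff)
  qed
  then have "Poly_Mapping.lookup (polytabloid n T) (tabloid_of n U) =
      (\<Sum>\<sigma>\<in>column_stabilizer n T. of_int (sign \<sigma>) * (\<Prod>x\<in>set (fst T). of_bool (\<sigma> x \<in> ?A)))"
    by (simp add: polytabloid_def lookup_sum lookup_cscale lookup_basis_vec cong: sum.cong)
  also have "\<dots> = (\<Prod>(a, b)\<in>columns T. of_bool (a \<in> ?A) - of_bool (b \<in> ?A))"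
    using assms(1) sum_sign_pair_stabilizer[of "fst T" "snd T" "\<lambda>x. of_bool (x \<in> ?A) :: complex"]
    by (auto simp: column_stabilizer_eq columns_def tableaux_def)
  finally show ?thesis .
qed

text \<open>The type \<open>tabloid\<close> contains every set of tableaux, so comparing
  coefficients must also cover sets that are not row-equivalence classes.\<close>

lemma lookup_polytabloid_eq_0:
  assumes "T \<in> tableaux n" "X \<notin> tabloid_of n ` tableaux n"
  shows "Poly_Mapping.lookup (polytabloid n T) X = 0"
proof -
  have "tabloid_of n (tableau_act \<sigma> T) \<noteq> X" if "\<sigma> \<in> column_stabilizer n T" for \<sigma>
    using assms tableau_act_tableaux[OF assms(1), of \<sigma>] that
    by (auto simp: column_stabilizer_def simp del: One_nat_def)
  then show ?thesis
    by (simp add: polytabloid_def lookup_sum lookup_cscale lookup_basis_vec)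
qed

section \<open>Relations between polytabloids\<close>

lemma polytabloid_cong_columns:
  assumes "T \<in> tableaux n" "T' \<in> tableaux n" "columns T = columns T'"
  shows "polytabloid n T = polytabloid n T'"
proof (rule poly_mapping_eqI)
  fix X
  show "Poly_Mapping.lookup (polytabloid n T) X = Poly_Mapping.lookup (polytabloid n T') X"
    using assms
    by (cases "X \<in> tabloid_of n ` tableaux n")
      (auto simp: lookup_polytabloid lookup_polytabloid_eq_0)
qed

text \<open>After the common product over \<open>C\<close> is factored out, what remains is the
  three-term identity for the indicator values at \<open>a\<close>, \<open>b\<close>,
  \<open>c\<close>, \<open>d\<close>. The inequalities and the conditions on \<open>C\<close> ensure
  that in each column set the two extra columns are distinct and outside \<open>C\<close>, so that
  the products split.\<close>

lemma polytabloid_pluecker: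
  assumes "T \<in> tableaux n" "T' \<in> tableaux n" "T'' \<in> tableaux n" and "finite C"
    and "columns T = C \<union> {(a, c), (b, d)}" "columns T' = C \<union> {(a, b), (c, d)}"
      "columns T'' = C \<union> {(a, d), (b, c)}"
    and "a \<noteq> b" "a \<noteq> c"
    and "\<And>y. (a, y) \<notin> C" "\<And>y. (b, y) \<notin> C" "\<And>y. (c, y) \<notin> C"
  shows "polytabloid n T = polytabloid n T' + polytabloid n T''"
proof (rule poly_mapping_eqI)
  fix X
  show "Poly_Mapping.lookup (polytabloid n T) X =
    Poly_Mapping.lookup (polytabloid n T' + polytabloid n T'') X"
  proof (cases "X \<in> tabloid_of n ` tableaux n")
    case True
    then obtain U where "U \<in> tableaux n" "X = tabloid_of n U" by auto
    then show ?thesis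
      using assms by (simp add: lookup_add lookup_polytabloid algebra_simps)
  next
    case False
    then show ?thesis using assms by (simp add: lookup_add lookup_polytabloid_eq_0)
  qed
qed

section \<open>The symmetric group acting on polytabloids\<close>

lemma lookup_push_forward_inj:
  assumes "inj f"
  shows "Poly_Mapping.lookup (push_forward f x) (f a) = Poly_Mapping.lookup x a"
proof -
  have "Poly_Mapping.lookup (push_forward f x) (f a) =
      (\<Sum>b\<in>Poly_Mapping.keys x. if b = a then Poly_Mapping.lookup x b else 0)"
    unfolding push_forward_def lookup_sum lookup_cscale lookup_basis_vec
    by (rule sum.cong) (simp_all add: inj_eq[OF assms])
  also have "\<dots> = Poly_Mapping.lookup x a"
    by (simp add: sum.delta in_keys_iff)
  finally show ?thesis .
qed

lemma tableau_act_comp: "tableau_act \<sigma> (tableau_act \<tau> T) = tableau_act (\<sigma> \<circ> \<tau>) T"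
  by (cases T) (simp add: tableau_act_def)

lemma tableau_act_id: "tableau_act id T = T"
  by (cases T) (simp add: tableau_act_def)

text \<open>One inclusion holds for every permutation; the reverse one is the same inclusion for the
  inverse permutation at \<open>tableau_act \<sigma> T\<close>.\<close>

lemma tableau_act_image_tabloid:
  assumes "T \<in> tableaux n" "\<sigma> permutes {1..2 * n}"
  shows "tableau_act \<sigma> ` tabloid_of n T = tabloid_of n (tableau_act \<sigma> T)"
proof -
  have sub: "tableau_act \<pi> ` tabloid_of n U \<subseteq> tabloid_of n (tableau_act \<pi> U)"
    if "U \<in> tableaux n" "\<pi> permutes {1..2 * n}" for \<pi> U
    using that tableau_act_tableaux
    by (auto simp: tabloid_of_def row_equiv_def tableau_act_def)
  have inv: "inv_into UNIV \<sigma> permutes {1..2 * n}"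
    using assms(2) by (rule permutes_inv)
  have c: "\<sigma> \<circ> inv_into UNIV \<sigma> = id" "inv_into UNIV \<sigma> \<circ> \<sigma> = id"
    using permutes_inv_o[OF assms(2)] by auto
  have "tabloid_of n (tableau_act \<sigma> T) =
      tableau_act \<sigma> ` tableau_act (inv_into UNIV \<sigma>) ` tabloid_of n (tableau_act \<sigma> T)"
    by (simp add: image_image tableau_act_comp tableau_act_id c)
  also have "\<dots> \<subseteq> tableau_act \<sigma> ` tabloid_of n T"
    using sub[OF tableau_act_tableaux[OF assms] inv]
    by (intro image_mono) (simp add: tableau_act_comp tableau_act_id c)
  finally show ?thesis using sub[OF assms] by blast
qed

text \<open>The coefficients are compared directly, without conjugating column stabilizers: the
  coefficient at \<open>X\<close> on the left is that of \<open>polytabloid n T\<close> at the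
  preimage \<open>Y\<close>, and applying \<sigma> to both the columns and the top row preserves
  membership.\<close>

lemma specht_act_polytabloid:
  assumes "T \<in> tableaux n" and perm: "\<sigma> permutes {1..2 * n}"
  shows "specht_act \<sigma> (polytabloid n T) = polytabloid n (tableau_act \<sigma> T)"
proof (rule poly_mapping_eqI)
  fix X
  have inv: "inv_into UNIV \<sigma> permutes {1..2 * n}" using perm by (rule permutes_inv)
  have c: "\<sigma> \<circ> inv_into UNIV \<sigma> = id" "inv_into UNIV \<sigma> \<circ> \<sigma> = id"
    using permutes_inv_o[OF perm] by auto
  \<comment> \<open>The push-forward runs over all sets of tableaux, so injectivity is needed on the
    whole type; the inverse permutation supplies a left inverse.\<close>
  have inj: "inj (\<lambda>X. tableau_act \<sigma> ` X)"
    by (rule inj_on_inverseI[where g = "\<lambda>X. tableau_act (inv_into UNIV \<sigma>) ` X"])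
      (simp add: image_image tableau_act_comp tableau_act_id c)
  define Y where "Y = tableau_act (inv_into UNIV \<sigma>) ` X"
  have X: "X = tableau_act \<sigma> ` Y"
    by (simp add: Y_def image_image tableau_act_comp tableau_act_id c)
  have lookup: "Poly_Mapping.lookup (specht_act \<sigma> (polytabloid n T)) X =
      Poly_Mapping.lookup (polytabloid n T) Y"
    unfolding specht_act_def X by (rule lookup_push_forward_inj[OF inj])
  show "Poly_Mapping.lookup (specht_act \<sigma> (polytabloid n T)) X =
    Poly_Mapping.lookup (polytabloid n (tableau_act \<sigma> T)) X"
  proof (cases "Y \<in> tabloid_of n ` tableaux n")
    case True
    then obtain U where U: "U \<in> tableaux n" "Y = tabloid_of n U" by auto
    have XU: "X = tabloid_of n (tableau_act \<sigma> U)"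
      using tableau_act_image_tabloid[OF U(1) perm] U(2) X by simp
    have inj\<sigma>: "inj \<sigma>" using perm by (rule permutes_inj)
    have "inj_on (map_prod \<sigma> \<sigma>) (columns T)"
      by (rule inj_on_subset[OF prod.inj_map[OF inj\<sigma> inj\<sigma>]]) simp
    then show ?thesis
      unfolding lookup U(2)
      unfolding XU lookup_polytabloid[OF assms(1) U(1)]
        lookup_polytabloid[OF tableau_act_tableaux[OF assms] tableau_act_tableaux[OF U(1) perm]]
        columns_tableau_act
      by (subst prod.reindex)
        (auto simp: tableau_act_def inj_image_mem_iff[OF inj\<sigma>] split_beta)
  next
    case False
    moreover have "X \<notin> tabloid_of n ` tableaux n"
    proof
      assume "X \<in> tabloid_of n ` tableaux n"
      then obtain U where "U \<in> tableaux n" "X = tabloid_of n U" by auto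
      then have "Y = tabloid_of n (tableau_act (inv_into UNIV \<sigma>) U)" "tableau_act (inv_into UNIV \<sigma>) U \<in> tableaux n"
        using tableau_act_image_tabloid[OF _ inv] tableau_act_tableaux[OF _ inv]
        by (auto simp: Y_def)
      with False show False by blast
    qed
    ultimately show ?thesis
      using assms lookup by (simp add: lookup_polytabloid_eq_0 tableau_act_tableaux)
  qed
qed


section \<open>Arcs of cup diagrams as columns of tableaux\<close>

text \<open>Arcs written with the left endpoint first can be compared with \<open>columns\<close>,
  and the natural number difference \<open>y - x\<close> is their true length.\<close>

definition arcs :: "web \<Rightarrow> (nat \<times> nat) set"
  where "arcs w = {(x, y). x < y \<and> {x, y} \<in> w}"

lemma cup_diagram_arc:
  assumes "w \<in> cup_diagrams n" "{i, j} \<in> w"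
  shows "i \<noteq> j" "i \<in> {1..2 * n}" "j \<in> {1..2 * n}"
proof -
  have "card {i, j} = 2" "{i, j} \<subseteq> {1..2 * n}"
    using assms by (auto simp: cup_diagrams_def partition_on_def)
  then show "i \<noteq> j" "i \<in> {1..2 * n}" "j \<in> {1..2 * n}" by (auto simp: card_insert_if split: if_splits)
qed

lemma cup_diagram_unique:
  assumes "w \<in> cup_diagrams n" "{i, j} \<in> w" "{i, k} \<in> w"
  shows "j = k"
proof -
  have "disjoint w" using assms(1) by (auto simp: cup_diagrams_def partition_on_def)
  then have "{i, j} = {i, k}" using assms(2,3) by (auto dest: disjointD)
  then show ?thesis by (auto simp: doubleton_eq_iff)
qed

lemma partner_eqI:
  assumes "w \<in> cup_diagrams n" "{i, j} \<in> w"
  shows "partner w i = j"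
  unfolding partner_def using assms cup_diagram_unique by blast

lemma cup_diagram_ex_arc:
  assumes "w \<in> cup_diagrams n" "i \<in> {1..2 * n}"
  obtains j where "{i, j} \<in> w"
proof -
  have "\<Union>w = {1..2 * n}" "\<forall>e\<in>w. card e = 2"
    using assms(1) by (auto simp: cup_diagrams_def partition_on_def)
  then obtain e where e: "e \<in> w" "i \<in> e" "card e = 2" using assms(2) by blast
  then obtain a b where "e = {a, b}" by (auto simp: card_2_iff)
  with e that show thesis by (auto simp: insert_commute)
qed

lemma finite_arcs:
  assumes "w \<in> cup_diagrams n"
  shows "finite (arcs w)"
  by (rule finite_subset[of _ "{1..2 * n} \<times> {1..2 * n}"])
    (use cup_diagram_arc[OF assms] in \<open>auto simp: arcs_def\<close>)

text \<open>By assumption every column is an arc. Conversely, the left endpoint of an arc occurs in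
  some column, and since a dot lies on only one arc, that column is the given arc.\<close>

lemma columns_eq_arcs:
  assumes w: "w \<in> cup_diagrams n" and T: "T \<in> tableaux n" "columns_are_arcs n w T"
  shows "columns T = arcs w"
proof (intro equalityI subrelI)
  show "(x, y) \<in> arcs w" if "(x, y) \<in> columns T" for x y
    using that T by (auto simp: columns_conv_nth columns_are_arcs_def arcs_def)
next
  fix x y assume xy: "(x, y) \<in> arcs w"
  then have arc: "{x, y} \<in> w" "x < y" by (auto simp: arcs_def)
  have "x \<in> set (fst T) \<union> set (snd T)"
    using cup_diagram_arc[OF w arc(1)] T(1) by (auto simp: tableaux_def)
  then obtain j where j: "j < n" "x = fst T ! j \<or> x = snd T ! j"
    using T(1) by (auto simp: tableaux_def in_set_conv_nth)
  moreover have col: "{fst T ! j, snd T ! j} \<in> w" "fst T ! j < snd T ! j"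
    using T(2) j(1) by (auto simp: columns_are_arcs_def)
  ultimately have "x = fst T ! j \<and> y = snd T ! j"
    using cup_diagram_unique[OF w arc(1)] arc(2) by (metis insert_commute less_asym)
  then show "(x, y) \<in> columns T"
    using j(1) T(1) by (auto simp: columns_conv_nth)
qed

text \<open>List the arcs in any order, with left endpoints as the top row and right endpoints as
  the bottom row. As every dot lies on exactly one arc, each entry occurs exactly once.\<close>

lemma ex_tableau_columns_are_arcs:
  assumes w: "w \<in> cup_diagrams n"
  shows "\<exists>T\<in>tableaux n. columns_are_arcs n w T"
proof -
  obtain xs where xs: "set xs = arcs w" "distinct xs"
    using finite_distinct_list[OF finite_arcs[OF w]] by auto
  note unique = cup_diagram_unique[OF w]
  have "inj_on fst (arcs w)" "inj_on snd (arcs w)"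
    using unique by (auto simp: inj_on_def arcs_def insert_commute)
  moreover have "fst ` arcs w \<inter> snd ` arcs w = {}"
  proof -
    have False if "x < z" "z < y" "{x, z} \<in> w" "{z, y} \<in> w" for x y z
      using unique[of z x y] that by (simp add: insert_commute)
    then show ?thesis by (auto simp: arcs_def)
  qed
  ultimately have dist: "distinct (map fst xs @ map snd xs)"
    using xs by (simp add: distinct_map)
  have "fst ` arcs w \<union> snd ` arcs w = {1..2 * n}"
  proof (intro equalityI subsetI)
    show "x \<in> {1..2 * n}" if "x \<in> fst ` arcs w \<union> snd ` arcs w" for x
      using that cup_diagram_arc[OF w] by (auto simp: arcs_def)
    fix x assume "x \<in> {1..2 * n}"
    then obtain y where y: "{x, y} \<in> w" by (rule cup_diagram_ex_arc[OF w])
    then have "(x, y) \<in> arcs w \<or> (y, x) \<in> arcs w"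
      using cup_diagram_arc(1)[OF w y] by (auto simp: arcs_def insert_commute)
    then show "x \<in> fst ` arcs w \<union> snd ` arcs w" by force
  qed
  then have set: "set (map fst xs @ map snd xs) = {1..2 * n}" using xs by simp
  have "length xs = n"
    using distinct_card[OF dist] set by simp
  then have "(map fst xs, map snd xs) \<in> tableaux n"
    using dist set by (simp add: tableaux_def)
  moreover have "columns_are_arcs n w (map fst xs, map snd xs)"
    using xs(1) \<open>length xs = n\<close> by (force simp: columns_are_arcs_def arcs_def dest: nth_mem)
  ultimately show ?thesis by blast
qed

section \<open>The base diagram \<open>w\<^sub>0\<close> and its characterization\<close>

lemma w\<^sub>0_cup_diagram: "w\<^sub>0 n \<in> cup_diagrams n"
proof -
  have "\<exists>j<n. i \<in> {2 * j + 1, 2 * j + 2}" if "i \<in> {1..2 * n}" for i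
    \<comment> \<open>Arcs are counted from zero and dots from one, hence the shift before
      halving.\<close>
    by (rule exI[of _ "(i - 1) div 2"]) (use that in auto)
  then have "\<Union>(w\<^sub>0 n) = {1..2 * n}" by (fastforce simp: w\<^sub>0_def)
  moreover have "disjoint (w\<^sub>0 n)"
  proof (rule disjointI)
    fix e f assume "e \<in> w\<^sub>0 n" "f \<in> w\<^sub>0 n" "e \<noteq> f"
    then obtain i j where "e = {2 * i + 1, 2 * i + 2}" "f = {2 * j + 1, 2 * j + 2}" "i \<noteq> j"
      by (auto simp: w\<^sub>0_def)
    moreover have "2 * a + 1 \<noteq> 2 * b" for a b :: nat by presburger
    ultimately show "e \<inter> f = {}" by (auto dest: sym)
  qed
  moreover have "{} \<notin> w\<^sub>0 n" by (auto simp: w\<^sub>0_def)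
  ultimately have "partition_on {1..2 * n} (w\<^sub>0 n)" by (simp add: partition_on_def)
  \<comment> \<open>No dot lies strictly between neighbours, so such an arc cannot take part in a
    crossing.\<close>
  moreover have "k = i + 1" if "{i, k} \<in> w\<^sub>0 n" "i < k" for i k
  proof -
    obtain j where "{i, k} = {2 * j + 1, 2 * j + 2}" using \<open>{i, k} \<in> w\<^sub>0 n\<close> by (auto simp: w\<^sub>0_def)
    then show ?thesis using \<open>i < k\<close> unfolding doubleton_eq_iff by linarith
  qed
  moreover have "\<forall>e\<in>w\<^sub>0 n. card e = 2" by (auto simp: w\<^sub>0_def)
  ultimately show ?thesis unfolding cup_diagrams_def by fastforce
qed

lemma T\<^sub>0_tableau: "T\<^sub>0 n \<in> tableaux n" "columns_are_arcs n (w\<^sub>0 n) (T\<^sub>0 n)"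
proof -
  have "i \<in> (\<lambda>j. 2 * j + 1) ` {..<n} \<union> (\<lambda>j. 2 * j + 2) ` {..<n}" if "i \<in> {1..2 * n}" for i
  proof -
    have "(i - 1) div 2 < n" "i = 2 * ((i - 1) div 2) + 1 \<or> i = 2 * ((i - 1) div 2) + 2"
      using that by auto
    then show ?thesis by blast
  qed
  then have "{1..2 * n} \<subseteq> (\<lambda>j. 2 * j + 1) ` {..<n} \<union> (\<lambda>j. 2 * j + 2) ` {..<n}" by blast
  moreover have "(\<lambda>j. 2 * j + 1) ` {..<n} \<union> (\<lambda>j. 2 * j + 2) ` {..<n} \<subseteq> {1..2 * n}" by auto
  ultimately have "(\<lambda>j. 2 * j + 1) ` {..<n} \<union> (\<lambda>j. 2 * j + 2) ` {..<n} = {1..2 * n}" by blast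
  moreover have "2 * i + 1 \<noteq> 2 * j + 2" for i j :: nat by presburger
  ultimately show "T\<^sub>0 n \<in> tableaux n"
    by (auto simp: tableaux_def T\<^sub>0_def distinct_map inj_on_def atLeast0LessThan)
  show "columns_are_arcs n (w\<^sub>0 n) (T\<^sub>0 n)"
    by (auto simp: columns_are_arcs_def T\<^sub>0_def w\<^sub>0_def)
qed

text \<open>Going from left to right, dot \<open>2 * j\<close> is already joined to
  \<open>2 * j - 1\<close>, so the only neighbour left for \<open>2 * j + 1\<close> is
  \<open>2 * j + 2\<close>.\<close>

lemma cup_diagram_adjacent_eq_w\<^sub>0:
  assumes w: "w \<in> cup_diagrams n" and adj: "\<And>p q. {p, q} \<in> w \<Longrightarrow> p < q \<Longrightarrow> q = p + 1"
  shows "w = w\<^sub>0 n"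
proof -
  have mem: "{2 * j + 1, 2 * j + 2} \<in> w" if "j < n" for j
    using that
  proof (induction j rule: less_induct)
    case (less j)
    have "2 * j + 1 \<in> {1..2 * n}" using less.prems by auto
    then obtain r where r: "{2 * j + 1, r} \<in> w" by (rule cup_diagram_ex_arc[OF w])
    have "2 * j + 1 \<noteq> r" "r \<ge> 1" using cup_diagram_arc[OF w r] by auto
    then consider "r = 2 * j + 2" | "2 * j = r"
      using adj[of "2 * j + 1" r] adj[of r "2 * j + 1"] r
      by (cases "2 * j + 1 < r") (auto simp: insert_commute)
    then show ?case
    proof cases
      case 2
      then have "j \<ge> 1" using \<open>r \<ge> 1\<close> by auto
      then have "{2 * (j - 1) + 1, 2 * (j - 1) + 2} \<in> w" using less by simp
      moreover have "2 * (j - 1) + 2 = r" using 2 \<open>j \<ge> 1\<close> by auto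
      ultimately have "2 * (j - 1) + 1 = 2 * j + 1"
        using cup_diagram_unique[OF w, of r "2 * (j - 1) + 1" "2 * j + 1"] r
        by (simp add: insert_commute)
      then show ?thesis using \<open>j \<ge> 1\<close> by simp
    qed (use r in simp)
  qed
  show ?thesis
  proof (intro equalityI subsetI)
    show "e \<in> w" if "e \<in> w\<^sub>0 n" for e using that mem by (auto simp: w\<^sub>0_def)
    \<comment> \<open>A perfect matching contained in another equals it: the arc of
      \<open>w\<^sub>0\<close> at an endpoint of \<open>e\<close> also lies in \<open>w\<close>,
      hence is \<open>e\<close>.\<close>
    fix e assume e: "e \<in> w"
    then have "card e = 2" using w by (auto simp: cup_diagrams_def)
    then obtain a b where ab: "e = {a, b}" by (auto simp: card_2_iff)
    have "a \<in> {1..2 * n}" using cup_diagram_arc[OF w] e ab by blast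
    then obtain c where c: "{a, c} \<in> w\<^sub>0 n" by (rule cup_diagram_ex_arc[OF w\<^sub>0_cup_diagram])
    then have "{a, c} \<in> w" using mem by (auto simp: w\<^sub>0_def)
    then have "b = c" using cup_diagram_unique[OF w] e ab by blast
    then show "e \<in> w\<^sub>0 n" using c ab by simp
  qed
qed

section \<open>Unnesting an arc\<close>

text \<open>Take a shortest arc \<open>{p, q}\<close> among those joining dots that are not
  neighbours. Noncrossing traps the arc at \<open>p + 1\<close> inside it; being shorter, that arc
  joins neighbours and so ends at \<open>p + 2\<close>.\<close>

lemma cup_diagram_nested_arcs:
  assumes w: "w \<in> cup_diagrams n" and "w \<noteq> w\<^sub>0 n"
  obtains p q where "p + 2 < q" "{p, q} \<in> w" "{p + 1, p + 2} \<in> w"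
proof -
  let ?P = "\<lambda>(p, q). {p, q} \<in> w \<and> p + 1 < q"
  obtain p' q' where "{p', q'} \<in> w" "p' < q'" "q' \<noteq> p' + 1"
    using cup_diagram_adjacent_eq_w\<^sub>0[OF w] assms(2) by blast
  then have "?P (p', q')" by auto
  from ex_has_least_nat[of ?P, OF this, of "\<lambda>(p, q). q - p"]
  obtain p q where pq: "{p, q} \<in> w" "p + 1 < q"
    and least: "\<And>a b. {a, b} \<in> w \<Longrightarrow> a + 1 < b \<Longrightarrow> q - p \<le> b - a"
    by auto
  have cross: False if "i < j" "j < k" "k < l" "{i, k} \<in> w" "{j, l} \<in> w" for i j k l
    using w that by (auto simp: cup_diagrams_def)
  have "p + 1 \<in> {1..2 * n}" using cup_diagram_arc[OF w pq(1)] pq(2) by auto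
  then obtain r where r: "{p + 1, r} \<in> w" by (rule cup_diagram_ex_arc[OF w])
  have "r \<noteq> p" using cup_diagram_unique[OF w, of p "p + 1" q] r pq by (auto simp: insert_commute)
  moreover have "r \<noteq> q" using cup_diagram_unique[OF w, of q "p + 1" p] r pq by (auto simp: insert_commute)
  moreover have "\<not> r < p" using cross[of r p "p + 1" q] r pq by (auto simp: insert_commute)
  moreover have "\<not> q < r" using cross[of p "p + 1" q r] r pq by auto
  moreover have "r \<noteq> p + 1" using cup_diagram_arc(1)[OF w r] by auto
  ultimately have "p + 1 < r" "r < q" by auto
  moreover have "\<not> p + 2 < r"
    using least[OF r] calculation by auto
  ultimately have "r = p + 2" by auto
  then show thesis using that[of p q] pq r \<open>r < q\<close> by auto
qed

definition unnest :: "nat \<Rightarrow> nat \<Rightarrow> web \<Rightarrow> web"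
  where "unnest p q w = (w - {{p, q}, {p + 1, p + 2}}) \<union> {{p, p + 1}, {p + 2, q}}"

context
  fixes n w p q
  assumes w: "w \<in> cup_diagrams n" and pq: "p + 2 < q" "{p, q} \<in> w" "{p + 1, p + 2} \<in> w"
begin

lemma no_other_arc:
  assumes "{i, j} \<in> w" "{i, j} \<noteq> {p, q}" "{i, j} \<noteq> {p + 1, p + 2}"
  shows "i \<notin> {p, p + 1, p + 2, q}" "j \<notin> {p, p + 1, p + 2, q}"
proof -
  have "i \<notin> {p, p + 1, p + 2, q}"
    if "{i, j} \<in> w" "{i, j} \<noteq> {p, q}" "{i, j} \<noteq> {p + 1, p + 2}" for i j
  proof
    assume "i \<in> {p, p + 1, p + 2, q}"
    then consider "i = p" | "i = p + 1" | "i = p + 2" | "i = q" by auto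
    then show False
      using that pq cup_diagram_unique[OF w]
      by cases (metis insert_commute)+
  qed
  from this[of i j] this[of j i] assms
  show "i \<notin> {p, p + 1, p + 2, q}" "j \<notin> {p, p + 1, p + 2, q}"
    by (simp_all add: insert_commute)
qed

text \<open>The old and new pairs of arcs cover the same four dots, so the matching stays perfect.
  An untouched arc crossing \<open>{p + 2, q}\<close> would already have crossed
  \<open>{p, q}\<close>.\<close>

lemma unnest_cup_diagram: "unnest p q w \<in> cup_diagrams n"
proof -
  let ?D = "{{p, q}, {p + 1, p + 2}}" and ?D' = "{{p, p + 1}, {p + 2, q}}"
  have part: "partition_on {1..2 * n} w" and card: "\<forall>e\<in>w. card e = 2"
    using w by (auto simp: cup_diagrams_def)
  have cross: False if "i < j" "j < k" "k < l" "{i, k} \<in> w" "{j, l} \<in> w" for i j k l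
    using w that by (auto simp: cup_diagrams_def)
  have old: "e \<inter> {p, p + 1, p + 2, q} = {}" if "e \<in> w - ?D" for e
  proof -
    have "card e = 2" using card that by blast
    then obtain a b where "e = {a, b}" by (auto simp: card_2_iff)
    with that no_other_arc[of a b] show ?thesis by auto
  qed
  have "\<Union>(unnest p q w) = \<Union>((w - ?D) \<union> ?D)"
    unfolding unnest_def Union_Un_distrib by auto
  also have "(w - ?D) \<union> ?D = w" using pq by blast
  finally have "\<Union>(unnest p q w) = \<Union>w" .
  moreover have "disjoint (unnest p q w)"
  proof (rule disjointI)
    fix e f assume ef: "e \<in> unnest p q w" "f \<in> unnest p q w" "e \<noteq> f"
    have D': "d \<subseteq> {p, p + 1, p + 2, q}" if "d \<in> ?D'" for d using that by auto
    have "e \<in> w - ?D \<or> e \<in> ?D'" "f \<in> w - ?D \<or> f \<in> ?D'"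
      using ef(1,2) by (simp_all only: unnest_def Un_iff)
    then consider "e \<in> w - ?D" "f \<in> w - ?D" | "e \<in> w - ?D" "f \<in> ?D'" | "e \<in> ?D'" "f \<in> w - ?D"
      | "e \<in> ?D'" "f \<in> ?D'"
      by argo
    then show "e \<inter> f = {}"
    proof cases
      case 1
      then show ?thesis using part ef(3) by (auto simp: partition_on_def dest: disjointD)
    next
      case 2
      then show ?thesis using old[of e] D'[of f] by blast
    next
      case 3
      then show ?thesis using old[of f] D'[of e] by blast
    next
      case 4
      then show ?thesis using ef(3) pq(1) by auto
    qed
  qed
  moreover have "{} \<notin> unnest p q w"
    using part by (auto simp: unnest_def partition_on_def)
  ultimately have "partition_on {1..2 * n} (unnest p q w)"
    using part by (auto simp: partition_on_def)
  moreover have "\<forall>e\<in>unnest p q w. card e = 2"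
    using card pq(1) by (auto simp: unnest_def)
  moreover have False
    if ijkl: "i < j" "j < k" "k < l" and e: "{i, k} \<in> unnest p q w" and f: "{j, l} \<in> unnest p q w"
    for i j k l
  proof -
    have "{i, k} \<in> w - ?D \<or> (i = p \<and> k = p + 1) \<or> (i = p + 2 \<and> k = q)"
      using e ijkl pq(1) by (auto simp: unnest_def doubleton_eq_iff)
    moreover have "{j, l} \<in> w - ?D \<or> (j = p \<and> l = p + 1) \<or> (j = p + 2 \<and> l = q)"
      using f ijkl pq(1) by (auto simp: unnest_def doubleton_eq_iff)
    \<comment> \<open>The arc \<open>{p, p + 1}\<close> drops out because no dot lies strictly
      between its ends.\<close>
    ultimately consider "{i, k} \<in> w" "{j, l} \<in> w" | "{j, l} \<in> w" "i = p + 2" "k = q"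
      | "{i, k} \<in> w - ?D" "j = p + 2" "l = q"
      using ijkl by auto
    then show False
    proof cases
      case 1
      then show ?thesis using cross ijkl by blast
    next
      case 2
      then have "p < j" "j < q" "q < l" using ijkl by auto
      with 2 show ?thesis using cross[of p j q l] pq(2) by blast
    next
      case 3
      then have "i \<noteq> p" "i \<noteq> p + 1" "{i, k} \<in> w" using old[of "{i, k}"] by blast+
      moreover have "i < p" "p < k" "k < q" using 3 ijkl calculation by auto
      ultimately show ?thesis using cross[of i p k q] pq(2) by blast
    qed
  qed
  ultimately show ?thesis unfolding cup_diagrams_def by blast
qed

text \<open>This selects the second case of the skein rule for the unnested diagram.\<close>

lemma middle_arc_notin_unnest: "{p + 1, p + 2} \<notin> unnest p q w"
  using pq by (auto simp: unnest_def doubleton_eq_iff)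

lemma reconnect_unnest: "reconnect (p + 1) (unnest p q w) = w"
proof -
  have "partner (unnest p q w) (p + 1) = p" "partner (unnest p q w) (p + 1 + 1) = q"
    using partner_eqI[OF unnest_cup_diagram] by (auto simp: unnest_def insert_commute)
  \<comment> \<open>Reconnecting deletes these two arcs, which therefore must not belong to
    \<open>w\<close> itself.\<close>
  moreover have "{p, p + 1} \<notin> w" "{p + 2, q} \<notin> w"
    using no_other_arc[of p "p + 1"] no_other_arc[of "p + 2" q] pq by (auto simp: doubleton_eq_iff)
  ultimately show ?thesis
    unfolding reconnect_def unnest_def using pq(2,3) by (auto simp: insert_commute)
qed

text \<open>The common part \<open>C\<close> avoids all four dots. Both the comparison of arc
  lengths and the three-term relation split the arcs in this way.\<close>

lemma arcs_unnest:
  obtains C where "finite C" "arcs w = C \<union> {(p, q), (p + 1, p + 2)}"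
    "arcs (unnest p q w) = C \<union> {(p, p + 1), (p + 2, q)}"
    "\<And>x y. (x, y) \<in> C \<Longrightarrow> x \<notin> {p, p + 1, p + 2, q} \<and> y \<notin> {p, p + 1, p + 2, q}"
proof
  let ?C = "{(x, y). x < y \<and> {x, y} \<in> w - {{p, q}, {p + 1, p + 2}}}"
  show "arcs w = ?C \<union> {(p, q), (p + 1, p + 2)}"
    using pq by (auto simp: arcs_def doubleton_eq_iff)
  then show "finite ?C" using finite_arcs[OF w] by simp
  show "arcs (unnest p q w) = ?C \<union> {(p, p + 1), (p + 2, q)}"
    using pq by (auto simp: arcs_def unnest_def doubleton_eq_iff)
  show "x \<notin> {p, p + 1, p + 2, q} \<and> y \<notin> {p, p + 1, p + 2, q}" if "(x, y) \<in> ?C" for x y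
    using that no_other_arc[of x y] by blast
qed

text \<open>The two replaced arcs have total length \<open>(q - p) + 1\<close>, the new ones
  \<open>1 + (q - p - 2)\<close>, so the sum drops by two.\<close>

lemma sum_arcs_unnest_less: "(\<Sum>(x, y)\<in>arcs (unnest p q w). y - x) < (\<Sum>(x, y)\<in>arcs w. y - x)"
proof -
  obtain C where C: "finite C" "arcs w = C \<union> {(p, q), (p + 1, p + 2)}"
    "arcs (unnest p q w) = C \<union> {(p, p + 1), (p + 2, q)}"
    "\<And>x y. (x, y) \<in> C \<Longrightarrow> x \<notin> {p, p + 1, p + 2, q} \<and> y \<notin> {p, p + 1, p + 2, q}"
    by (rule arcs_unnest) blast
  have "C \<inter> {(p, q), (p + 1, p + 2)} = {}" "C \<inter> {(p, p + 1), (p + 2, q)} = {}"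
    using C(4) by auto
  then show ?thesis
    unfolding C(2,3) using C(1) pq(1) by (simp add: sum.union_disjoint del: Un_insert_right)
qed

text \<open>This is the skein rule on the side of polytabloids. The transposition turns the columns
  \<open>(p, p + 1)\<close>, \<open>(p + 2, q)\<close> of \<open>U\<close> into
  \<open>(p, p + 2)\<close>, \<open>(p + 1, q)\<close>, and the three-term relation rewrites the
  result through the columns of \<open>U\<close> and of \<open>T\<close>.\<close>

lemma polytabloid_unnest:
  assumes "T \<in> tableaux n" "columns_are_arcs n w T"
    and "U \<in> tableaux n" "columns_are_arcs n (unnest p q w) U"
  shows "specht_act (transpose (p + 1) (p + 2)) (polytabloid n U) =
    polytabloid n U + polytabloid n T"
proof -
  obtain C where C: "finite C" "arcs w = C \<union> {(p, q), (p + 1, p + 2)}"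
    "arcs (unnest p q w) = C \<union> {(p, p + 1), (p + 2, q)}"
    "\<And>x y. (x, y) \<in> C \<Longrightarrow> x \<notin> {p, p + 1, p + 2, q} \<and> y \<notin> {p, p + 1, p + 2, q}"
    by (rule arcs_unnest) blast
  let ?s = "transpose (p + 1) (p + 2)"
  have s: "?s permutes {1..2 * n}"
    using cup_diagram_arc[OF w pq(3)] by (auto intro: permutes_swap_id)
  \<comment> \<open>The common columns contain neither of the exchanged entries.\<close>
  have "map_prod ?s ?s ` C = C"
  proof -
    have "map_prod ?s ?s z = z" if "z \<in> C" for z
      using that C(4) by (cases z) (auto simp: transpose_def)
    then show ?thesis by (simp cong: image_cong)
  qed
  then have "columns (tableau_act ?s U) = C \<union> {(p, p + 2), (p + 1, q)}"
    using columns_eq_arcs[OF unnest_cup_diagram assms(3,4)] C(3) pq(1)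
    by (simp add: columns_tableau_act image_Un transpose_def del: Un_insert_right)
  moreover have notin: "(p, y) \<notin> C" "(p + 1, y) \<notin> C" "(p + 2, y) \<notin> C" for y
    using C(4) by blast+
  ultimately have "polytabloid n (tableau_act ?s U) = polytabloid n U + polytabloid n T"
    using columns_eq_arcs[OF unnest_cup_diagram assms(3,4)] columns_eq_arcs[OF w assms(1,2)] C(1-3) notin
    by (intro polytabloid_pluecker[OF tableau_act_tableaux[OF assms(3) s] assms(3,1),
          where C = C and a = p and b = "p + 1" and c = "p + 2" and d = q]) auto
  then show ?thesis using specht_act_polytabloid[OF assms(3) s] by simp
qed

end

section \<open>Comparison of the two modules\<close>

lemma polytabloid_in_specht: "T \<in> tableaux n \<Longrightarrow> polytabloid n T \<in> specht n"
  by (simp add: specht_def free_vs.span_base)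

text \<open>With \<open>u\<close> the unnested diagram and \<open>s\<close> the transposition,
  \<open>basis_vec w\<close> is \<open>s\<close> applied to \<open>basis_vec u\<close> minus
  \<open>basis_vec u\<close>, and the polytabloid of \<open>T\<close> arises in the same way from
  that of \<open>U\<close>. Linearity and equivariance of \<rho> then carry the claim from
  \<open>u\<close> to \<open>w\<close>.\<close>

lemma specht_web_iso_polytabloid:
  assumes act: "web_action n act" and iso: "specht_web_iso n act \<rho>"
    and base: "\<rho> (polytabloid n (T\<^sub>0 n)) = basis_vec (w\<^sub>0 n)"
    and "w \<in> cup_diagrams n" "T \<in> tableaux n" "columns_are_arcs n w T"
  shows "\<rho> (polytabloid n T) = basis_vec w"
  using assms(4-6)
proof (induction "\<Sum>(x, y)\<in>arcs w. y - x" arbitrary: w T rule: less_induct)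
  case less
  note w = less.prems(1)
  show ?case
  proof (cases "w = w\<^sub>0 n")
    case True
    \<comment> \<open>\<open>T\<close> may list the columns of \<open>T\<^sub>0 n\<close> in another
      order.\<close>
    then have "polytabloid n T = polytabloid n (T\<^sub>0 n)"
      using less.prems columns_eq_arcs T\<^sub>0_tableau by (intro polytabloid_cong_columns) auto
    with base True show ?thesis by simp
  next
    case False
    then obtain p q where pq: "p + 2 < q" "{p, q} \<in> w" "{p + 1, p + 2} \<in> w"
      using cup_diagram_nested_arcs[OF w] by blast
    let ?u = "unnest p q w" and ?s = "transpose (p + 1) (p + 2)"
    have u: "?u \<in> cup_diagrams n" by (rule unnest_cup_diagram[OF w pq])
    obtain U where U: "U \<in> tableaux n" "columns_are_arcs n ?u U"
      using ex_tableau_columns_are_arcs[OF u] by blast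
    have IH: "\<rho> (polytabloid n U) = basis_vec ?u"
      by (rule less.hyps[OF sum_arcs_unnest_less[OF w pq] u U])
    have mem: "p + 1 \<in> {1..2 * n - 1}" "?s \<in> carrier (sym_group (2 * n))"
      using cup_diagram_arc[OF w pq(3)] by (auto simp: sym_group_def intro!: permutes_swap_id)
    have "\<rho> (polytabloid n U) + \<rho> (polytabloid n T) = \<rho> (polytabloid n U + polytabloid n T)"
      using iso polytabloid_in_specht U(1) less.prems(2)
      by (simp add: specht_web_iso_def linear_on_def)
    also have "\<dots> = \<rho> (specht_act ?s (polytabloid n U))"
      using polytabloid_unnest[OF w pq less.prems(2,3) U] by simp
    also have "\<dots> = act ?s (basis_vec ?u)"
      using iso mem(2) polytabloid_in_specht[OF U(1)] IH by (simp add: specht_web_iso_def)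
    also have "\<dots> = basis_vec ?u + basis_vec (reconnect (p + 1) ?u)"
      using act u mem(1) middle_arc_notin_unnest[OF w pq] by (auto simp: web_action_def)
    finally show ?thesis using IH reconnect_unnest[OF w pq] by simp
  qed
qed

theorem proposition1p2:
  fixes n :: nat
    and act :: "(nat \<Rightarrow> nat) \<Rightarrow> (web \<Rightarrow>\<^sub>0 complex) \<Rightarrow> (web \<Rightarrow>\<^sub>0 complex)"
    and \<rho> :: "(tabloid \<Rightarrow>\<^sub>0 complex) \<Rightarrow> (web \<Rightarrow>\<^sub>0 complex)"
    and \<psi> :: "(web \<Rightarrow>\<^sub>0 complex) \<Rightarrow> (tabloid \<Rightarrow>\<^sub>0 complex)"
    and w :: web
  assumes "n \<ge> 1"
    and "web_action n act"
    and "specht_web_iso n act \<rho>"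
    and "\<rho> (polytabloid n (T\<^sub>0 n)) = basis_vec (w\<^sub>0 n)"
    and "\<psi> = inv_into (specht n) \<rho>"
    and "w \<in> cup_diagrams n"
  shows "(\<exists>T\<in>tableaux n. columns_are_arcs n w T) \<and>
    (\<forall>T\<in>tableaux n. columns_are_arcs n w T \<longrightarrow> \<psi> (basis_vec w) = polytabloid n T) \<and>
    (\<forall>T\<in>tableaux n. \<forall>T'\<in>tableaux n. columns_are_arcs n w T \<longrightarrow> columns_are_arcs n w T' \<longrightarrow>
      polytabloid n T = polytabloid n T')"
proof -
  have "inj_on \<rho> (specht n)"
    using assms(3) by (auto simp: specht_web_iso_def bij_betw_def)
  then have "\<psi> (basis_vec w) = polytabloid n T"
    if "T \<in> tableaux n" "columns_are_arcs n w T" for T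
    unfolding assms(5) using specht_web_iso_polytabloid[OF assms(2-4,6) that]
      polytabloid_in_specht[OF that(1)] by (metis inv_into_f_f)
  \<comment> \<open>Any two polytabloids in the last conjunct agree because both equal
    \<open>\<psi> (basis_vec w)\<close>.\<close>
  then show ?thesis
    using ex_tableau_columns_are_arcs[OF assms(6)] by metis
qed

end
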